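(* Let $d\ge 3$ and $P\ge 1$ be integers. For any $\hat f, F\in C([0,1])$ and any $x\in\mathbb{R}^d$ with $\|x\|\le 1$, it holds that $$\mathcal E_{d,P}[\hat f,F](\|x\|)^2=\bigl|F(\|x\|)-\mathcal S_d[\hat f](\|x\|)\bigr|^2+\frac{\mathbb V_d[\hat f](\|x\|)}{P}.$$
   Context: For an integer $d\ge 3$ let $\varrho_d(t)=c_d(1-t^2)^{\frac{d-3}{2}}$ with $c_d=\frac{2\Gamma(d/2)}{\sqrt{\pi}\,\Gamma((d-1)/2)}$, and for $f\colon[0,1]\to\mathbb{R}$ define the slicing operator $\mathcal S_d[f](s)=\int_0^1 f(ts)\varrho_d(t)\,\mathrm{d}t$, $s\in[0,1]$. Let $\mathcal U_{\mathbb S^{d-1}}$ be the uniform distribution on the unit sphere $\mathbb S^{d-1}\subset\mathbb{R}^d$. For $f,F\in C([0,1])$ and $x\in\mathbb{R}^d$ with $\|x\|\le1$ (Euclidean norm) define the mean square error $$\mathcal E_{d,P}[f,F](\|x\|)^2=\mathbb E_{\xi_1,\dots,\xi_P\sim\mathcal U_{\mathbb S^{d-1}}}\Bigl[\Bigl(\frac1P\sum_{p=1}^P f(|\langle\xi_p,x\rangle|)-F(\|x\|)\Bigr)^2\Bigr],$$ where $\xi_1,\dots,\xi_P$ are independent (with $\mathcal E_{d,P}[f,F](\|x\|)\ge0$), and the variance $$\mathbb V_d[f](\|x\|)=\mathbb E_{\xi\sim\mathcal U_{\mathbb S^{d-1}}}\bigl[(f(|\langle\xi,x\rangle|)-\mathcal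 S_d[f](\|x\|))^2\bigr].$$ By rotation invariance both quantities depend on $x$ only through $\|x\|$. *)

theory Defs
  imports "HOL-Probability.Probability"
begin

(* The normalised cone measure: a Borel set A of the sphere gets the share of the volume of the
   unit ball that lies in the cone over A (sgn x = x / norm x).  The restriction makes the sphere
   itself the sample space. *)
definition unif_sphere :: "'a::euclidean_space measure" where
  "unif_sphere = restrict_space (distr (uniform_measure lborel (cball 0 1)) borel sgn) (sphere 0 1)"

definition slicing_const :: "nat \<Rightarrow> real" where
  "slicing_const d = 2 * Gamma (real d / 2) / (sqrt pi * Gamma ((real d - 1) / 2))"

(* For d = 3 the library convention 0 powr 0 = 0 makes the density 0 rather than slicing_const 3
   at t = 1, a single point that does not affect the integral. *)
definition slicing_density :: "nat \<Rightarrow> real \<Rightarrow> real" where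
  "slicing_density d t = slicing_const d * (1 - t\<^sup>2) powr ((real d - 3) / 2)"

(* A function on [0,1] is represented by a function on the reals whose values outside [0,1]
   are never used. *)
definition slicing :: "nat \<Rightarrow> (real \<Rightarrow> real) \<Rightarrow> real \<Rightarrow> real" where
  "slicing d f s = (LBINT t:{0..1}. f (t * s) * slicing_density d t)"

(* The dimension d is CARD('n).  By rotation invariance the next two quantities depend on x only
   through norm x; they are given as functions of x, as in their defining formulas. *)
definition slicing_error :: "nat \<Rightarrow> (real \<Rightarrow> real) \<Rightarrow> (real \<Rightarrow> real) \<Rightarrow> real ^ 'n \<Rightarrow> real" where
  "slicing_error P f F x =
     sqrt (LINT \<xi>|(\<Pi>\<^sub>M p\<in>{1..P}. unif_sphere).
       ((1 / real P) * (\<Sum>p=1..P. f \<bar>\<xi> p \<bullet> x\<bar>) - F (norm x))\<^sup>2)"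

definition slicing_variance :: "(real \<Rightarrow> real) \<Rightarrow> real ^ 'n \<Rightarrow> real" where
  "slicing_variance f x =
     (LINT \<xi>|unif_sphere. (f \<bar>\<xi> \<bullet> x\<bar> - slicing CARD('n) f (norm x))\<^sup>2)"

lemma sets_unif_sphere:
  "sets (unif_sphere :: 'a::euclidean_space measure) = sets (restrict_space borel (sphere 0 1))"
  by (simp add: unif_sphere_def sets_restrict_space)

lemma space_unif_sphere: "space (unif_sphere :: 'a::euclidean_space measure) = sphere 0 1"
  by (simp add: unif_sphere_def space_restrict_space)

lemma emeasure_unif_sphere:
  fixes A :: "'a::euclidean_space set"
  assumes "A \<in> sets borel" "A \<subseteq> sphere 0 1"
  shows "emeasure unif_sphere A =
    emeasure lborel (cball 0 1 \<inter> sgn -` A) / emeasure lborel (cball (0::'a) 1)"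
proof -
  have m: "sgn \<in> borel_measurable (uniform_measure lborel (cball (0::'a) 1))"
    unfolding sgn_div_norm by measurable
  have v: "sgn -` A \<in> sets borel"
    using measurable_sets[OF m assms(1)] by simp
  have "emeasure unif_sphere A = emeasure (distr (uniform_measure lborel (cball 0 1)) borel sgn) A"
    unfolding unif_sphere_def using assms by (subst emeasure_restrict_space) auto
  also have "\<dots> = emeasure (uniform_measure lborel (cball 0 1)) (sgn -` A)"
    using m assms by (subst emeasure_distr) auto
  also have "\<dots> = emeasure lborel (cball 0 1 \<inter> sgn -` A) / emeasure lborel (cball (0::'a) 1)"
    using v by (subst emeasure_uniform_measure) auto
  finally show ?thesis .
qed

lemma emeasure_lborel_unit_cball:
  "emeasure lborel (cball (0::'a::euclidean_space) 1) \<noteq> 0"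
  "emeasure lborel (cball (0::'a::euclidean_space) 1) \<noteq> \<infinity>"
  using unit_ball_vol_pos[of "real DIM('a)"] by (simp_all add: emeasure_cball del: unit_ball_vol_pos)

lemma prob_space_unif_sphere: "prob_space (unif_sphere :: 'a::euclidean_space measure)"
proof
  have eq: "cball 0 1 \<inter> sgn -` sphere 0 1 = cball (0::'a) 1 - {0}"
    by (auto simp: norm_sgn)
  have "emeasure lborel (cball (0::'a) 1 - {0}) = emeasure lborel (cball (0::'a) 1)"
    by (intro emeasure_Diff_null_set) auto
  then show "emeasure unif_sphere (space unif_sphere :: 'a set) = 1"
    using emeasure_lborel_unit_cball[where 'a='a]
    by (simp add: space_unif_sphere emeasure_unif_sphere eq ennreal_divide_self top.not_eq_extremum)
qed

end

(* The bias-variance identity for an i.i.d. sample needs only one fact about the slicing operator: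
   it is the expectation of f(|<xi, x>|), that is, |<xi, u>| has density slicing_density on [0,1]
   for every unit vector u.  The event |<xi, u>| >= a is the trace on the sphere of a double cone.
   Rotation invariance of Lebesgue measure turns the axis of the cone into a coordinate axis; by
   Fubini its slices are balls of dimension d - 1 with explicit radii, and the fundamental theorem
   of calculus for t (1 - t^2)^((d-1)/2) identifies the volume with the integral of the density
   over [a,1]. *)
theory Submission
  imports Defs
begin

section \<open>Mean squares of sums of independent samples\<close>

text \<open>Induction on \<open>I\<close>: Fubini integrates out the coordinate \<open>j\<close>,
  where the cross term vanishes because \<open>h\<close> has mean zero, so each index adds one
  second moment. The shift \<open>c\<close> is carried along unchanged and later holds the bias.
  Boundedness makes all integrals exist.\<close>

lemma (in prob_space) expectation_square_sum_iid:
  fixes h :: "'a \<Rightarrow> real" and c :: real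
  assumes h [measurable]: "random_variable borel h"
    and bnd: "\<And>x. x \<in> space M \<Longrightarrow> \<bar>h x\<bar> \<le> B"
    and mean: "expectation h = 0" and "finite I"
  shows "(LINT \<xi>|(\<Pi>\<^sub>M i\<in>I. M). ((\<Sum>i\<in>I. h (\<xi> i)) + c)\<^sup>2) =
    real (card I) * expectation (\<lambda>x. (h x)\<^sup>2) + c\<^sup>2"
  using \<open>finite I\<close>
proof induction
  case empty
  interpret PI: prob_space "\<Pi>\<^sub>M i\<in>{}. M" by (rule prob_space_PiM) unfold_locales
  show ?case by (simp add: PI.prob_space)
next
  case (insert j I)
  have int_h: "integrable M h"
    by (rule integrable_const_bound[of _ B]) (use bnd in auto)
  have int_h2: "integrable M (\<lambda>x. (h x)\<^sup>2)"
  proof (rule integrable_const_bound[of _ "B\<^sup>2"])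
    show "AE x in M. norm ((h x)\<^sup>2) \<le> B\<^sup>2"
      using power_mono[OF bnd abs_ge_zero, of _ 2] by auto
  qed simp
  interpret PP: product_sigma_finite "\<lambda>_. M" by unfold_locales
  have prob: "prob_space (\<Pi>\<^sub>M i\<in>J. M)" for J :: "'b set"
    by (rule prob_space_PiM) unfold_locales
  interpret PI: prob_space "\<Pi>\<^sub>M i\<in>I. M" by (rule prob)
  interpret PJ: prob_space "\<Pi>\<^sub>M i\<in>insert j I. M" by (rule prob)
  have sum_bnd: "\<bar>(\<Sum>i\<in>J. h (\<xi> i)) + c\<bar> \<le> real (card J) * B + \<bar>c\<bar>"
    if "\<xi> \<in> space (\<Pi>\<^sub>M i\<in>J. M)" for J :: "'b set" and \<xi>
  proof -
    have "\<bar>\<Sum>i\<in>J. h (\<xi> i)\<bar> \<le> (\<Sum>i\<in>J. \<bar>h (\<xi> i)\<bar>)" by (rule sum_abs)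
    also have "\<dots> \<le> (\<Sum>i\<in>J. B)"
      using that by (intro sum_mono bnd) (auto simp: space_PiM)
    finally show ?thesis by simp
  qed
  have square_bnd: "norm (((\<Sum>i\<in>J. h (\<xi> i)) + c)\<^sup>2) \<le> (real (card J) * B + \<bar>c\<bar>)\<^sup>2"
    if "\<xi> \<in> space (\<Pi>\<^sub>M i\<in>J. M)" for J :: "'b set" and \<xi>
    using power_mono[OF sum_bnd[OF that] abs_ge_zero, of 2] by simp
  have int': "integrable (\<Pi>\<^sub>M i\<in>insert j I. M) (\<lambda>\<xi>. ((\<Sum>i\<in>insert j I. h (\<xi> i)) + c)\<^sup>2)"
    using square_bnd by (intro PJ.integrable_const_bound[OF AE_I2]) auto
  have int: "integrable (\<Pi>\<^sub>M i\<in>I. M) (\<lambda>\<xi>. ((\<Sum>i\<in>I. h (\<xi> i)) + c)\<^sup>2)"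
    using square_bnd by (intro PI.integrable_const_bound[OF AE_I2]) auto
  have "(LINT \<xi>|(\<Pi>\<^sub>M i\<in>insert j I. M). ((\<Sum>i\<in>insert j I. h (\<xi> i)) + c)\<^sup>2) =
    (LINT \<xi>|(\<Pi>\<^sub>M i\<in>I. M). LINT y|M. ((\<Sum>i\<in>insert j I. h ((\<xi>(j := y)) i)) + c)\<^sup>2)"
    by (rule PP.product_integral_insert[OF insert.hyps int'])
  also have "\<dots> = (LINT \<xi>|(\<Pi>\<^sub>M i\<in>I. M). ((\<Sum>i\<in>I. h (\<xi> i)) + c)\<^sup>2 + expectation (\<lambda>x. (h x)\<^sup>2))"
  proof (intro Bochner_Integration.integral_cong refl)
    fix \<xi>
    let ?s = "(\<Sum>i\<in>I. h (\<xi> i)) + c"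
    have "(\<Sum>i\<in>insert j I. h ((\<xi>(j := y)) i)) = h y + (\<Sum>i\<in>I. h (\<xi> i))" for y
      using insert.hyps by (auto intro!: sum.cong)
    then have "(LINT y|M. ((\<Sum>i\<in>insert j I. h ((\<xi>(j := y)) i)) + c)\<^sup>2) =
      (LINT y|M. (?s\<^sup>2 + (h y)\<^sup>2) + 2 * ?s * h y)"
      by (intro Bochner_Integration.integral_cong refl) (simp add: power2_eq_square algebra_simps)
    also have "\<dots> = ?s\<^sup>2 + expectation (\<lambda>x. (h x)\<^sup>2)"
      using int_h int_h2 by (simp add: mean prob_space)
    finally show "(LINT y|M. ((\<Sum>i\<in>insert j I. h ((\<xi>(j := y)) i)) + c)\<^sup>2) =
      ?s\<^sup>2 + expectation (\<lambda>x. (h x)\<^sup>2)" .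
  qed
  also have "\<dots> = real (card (insert j I)) * expectation (\<lambda>x. (h x)\<^sup>2) + c\<^sup>2"
    using insert int by (simp add: PI.prob_space algebra_simps)
  finally show ?case .
qed

text \<open>Centring \<open>g\<close> at its mean splits the error into a sum of mean-zero terms and
  a constant shift, both divided by \<open>P\<close>. The shift yields the squared bias; the
  \<open>P\<close> equal second moments, divided by the square of \<open>P\<close>, leave the
  variance over \<open>P\<close>.\<close>

lemma (in prob_space) mean_square_error_iid:
  fixes g :: "'a \<Rightarrow> real" and c :: real and P :: nat
  assumes g [measurable]: "random_variable borel g"
    and bnd: "\<And>x. x \<in> space M \<Longrightarrow> \<bar>g x\<bar> \<le> B" and "P \<ge> 1"
  shows "(LINT \<xi>|(\<Pi>\<^sub>M p\<in>{1..P}. M). ((1 / real P) * (\<Sum>p=1..P. g (\<xi> p)) - c)\<^sup>2) =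
    (c - expectation g)\<^sup>2 + variance g / real P"
proof -
  let ?m = "expectation g"
  have int_g: "integrable M g"
    by (rule integrable_const_bound[of _ B]) (use bnd in auto)
  have "(LINT \<xi>|(\<Pi>\<^sub>M p\<in>{1..P}. M). ((1 / real P) * (\<Sum>p=1..P. g (\<xi> p)) - c)\<^sup>2) =
    (LINT \<xi>|(\<Pi>\<^sub>M p\<in>{1..P}. M).
      ((\<Sum>p=1..P. g (\<xi> p) - ?m) + real P * (?m - c))\<^sup>2 / (real P)\<^sup>2)"
  proof (intro Bochner_Integration.integral_cong refl)
    fix \<xi> :: "nat \<Rightarrow> 'a"
    have "(1 / real P) * (\<Sum>p=1..P. g (\<xi> p)) - c =
        ((\<Sum>p=1..P. g (\<xi> p) - ?m) + real P * (?m - c)) / real P"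
      using \<open>P \<ge> 1\<close> by (simp add: sum_subtractf right_diff_distrib diff_divide_distrib)
    then show "((1 / real P) * (\<Sum>p=1..P. g (\<xi> p)) - c)\<^sup>2 =
        ((\<Sum>p=1..P. g (\<xi> p) - ?m) + real P * (?m - c))\<^sup>2 / (real P)\<^sup>2"
      by (simp only: power_divide)
  qed
  also have "\<dots> = (real P * variance g + (real P * (?m - c))\<^sup>2) / (real P)\<^sup>2"
  proof -
    have "\<bar>g x - ?m\<bar> \<le> B + \<bar>?m\<bar>" if "x \<in> space M" for x
      using bnd[OF that] by linarith
    moreover have "expectation (\<lambda>x. g x - ?m) = 0"
      using int_g by (simp add: prob_space)
    ultimately show ?thesis
      using expectation_square_sum_iid[of "\<lambda>x. g x - ?m" "B + \<bar>?m\<bar>" "{1..P}" "real P * (?m - c)"]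
      by simp
  qed
  also have "\<dots> = (c - ?m)\<^sup>2 + variance g / real P"
    using \<open>P \<ge> 1\<close>
    by (simp add: add_divide_distrib power_mult_distrib power2_eq_square[of "real P"]
      power2_commute[of c])
  finally show ?thesis .
qed

section \<open>Rotation invariance of Lebesgue measure\<close>

text \<open>Both sides of \<open>M A * lborel U = lborel A * M U\<close>, with \<open>U\<close> the unit ball, are the double
  integral of \<open>indicator A x * indicator U (x + y)\<close>, in the two orders of integration.\<close>

lemma translation_invariant_eq_lborel:
  fixes M :: "'a::euclidean_space measure"
  assumes sets_M [measurable_cong]: "sets M = sets borel"
    and inv: "\<And>c. distr M borel ((+) c) = M"
    and ball: "emeasure M (cball 0 1) = emeasure lborel (cball (0::'a) 1)"
    and "sigma_finite_measure M"
  shows "M = lborel"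
proof (rule measure_eqI)
  interpret M: sigma_finite_measure M by fact
  interpret pair_sigma_finite M lborel by unfold_locales
  fix A assume "A \<in> sets M"
  then have [measurable]: "A \<in> sets borel" by (simp add: sets_M)
  let ?U = "cball (0::'a) 1"
  have [measurable]: "cball (0::'a) 1 \<in> sets borel" by simp
  let ?f = "indicator A :: 'a \<Rightarrow> ennreal" and ?g = "indicator ?U :: 'a \<Rightarrow> ennreal"
  have shift_lborel: "(\<integral>\<^sup>+y. h (c + y) \<partial>lborel) = (\<integral>\<^sup>+y. h y \<partial>lborel)"
    if [measurable]: "h \<in> borel_measurable borel" for h and c :: 'a
    by (subst (2) lborel_distr_plus[of c, symmetric], subst nn_integral_distr) auto
  have shift_M: "(\<integral>\<^sup>+y. h (c + y) \<partial>M) = (\<integral>\<^sup>+y. h y \<partial>M)"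
    if [measurable]: "h \<in> borel_measurable borel" for h and c :: 'a
    by (subst (2) inv[of c, symmetric], subst nn_integral_distr) (auto cong: measurable_cong_sets)
  \<comment> \<open>After the change of variables below, \<open>y\<close> enters through
    \<open>x - y\<close>; the reflection turns this back into a translation.\<close>
  have reflect: "(\<integral>\<^sup>+y. h (- y) \<partial>lborel) = (\<integral>\<^sup>+y. h y \<partial>lborel)"
    if [measurable]: "h \<in> borel_measurable borel" for h :: "'a \<Rightarrow> ennreal"
  proof -
    have "distr lborel borel (\<lambda>x::'a. 0 + (-1) *\<^sub>R x) = lborel"
      using lborel_affine[of "-1" "0::'a"] by (simp add: density_1)
    then have "(\<integral>\<^sup>+y. h y \<partial>lborel) = (\<integral>\<^sup>+y. h y \<partial>distr lborel borel (\<lambda>x::'a. 0 + (-1) *\<^sub>R x))"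
      by simp
    also have "\<dots> = (\<integral>\<^sup>+y. h (- y) \<partial>lborel)" by (subst nn_integral_distr) auto
    finally show ?thesis by simp
  qed
  have "emeasure M A * emeasure lborel ?U = (\<integral>\<^sup>+x. ?f x * (\<integral>\<^sup>+y. ?g y \<partial>lborel) \<partial>M)"
    by (simp add: nn_integral_multc nn_integral_cmult sets_M)
  also have "\<dots> = (\<integral>\<^sup>+x. \<integral>\<^sup>+y. ?f x * ?g (x + y) \<partial>lborel \<partial>M)"
  proof (rule nn_integral_cong)
    fix x
    have "(\<integral>\<^sup>+y. ?g (x + y) \<partial>lborel) = (\<integral>\<^sup>+y. ?g y \<partial>lborel)"
      by (rule shift_lborel, rule borel_measurable_indicator) simp
    then show "?f x * (\<integral>\<^sup>+y. ?g y \<partial>lborel) = (\<integral>\<^sup>+y. ?f x * ?g (x + y) \<partial>lborel)"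
      by (subst nn_integral_cmult) auto
  qed
  also have "\<dots> = (\<integral>\<^sup>+y. \<integral>\<^sup>+x. ?f x * ?g (x + y) \<partial>M \<partial>lborel)"
    by (subst Fubini') (auto simp: case_prod_unfold cong: measurable_cong_sets)
  \<comment> \<open>For fixed \<open>y\<close>, replacing \<open>x\<close> by \<open>x - y\<close>
    uses the translation invariance of \<open>M\<close>.\<close>
  also have "\<dots> = (\<integral>\<^sup>+y. \<integral>\<^sup>+x. ?f (x - y) * ?g x \<partial>M \<partial>lborel)"
  proof (rule nn_integral_cong)
    fix y
    show "(\<integral>\<^sup>+x. ?f x * ?g (x + y) \<partial>M) = (\<integral>\<^sup>+x. ?f (x - y) * ?g x \<partial>M)"
      using shift_M[of "\<lambda>x. ?f (x - y) * ?g x" y] by (simp add: add.commute)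
  qed
  also have "\<dots> = (\<integral>\<^sup>+x. \<integral>\<^sup>+y. ?f (x - y) * ?g x \<partial>lborel \<partial>M)"
    by (subst Fubini') (auto simp: case_prod_unfold cong: measurable_cong_sets)
  also have "\<dots> = (\<integral>\<^sup>+x. emeasure lborel A * ?g x \<partial>M)"
  proof (rule nn_integral_cong)
    fix x
    have "(\<integral>\<^sup>+y. ?f (x - y) \<partial>lborel) = (\<integral>\<^sup>+y. ?f (x + y) \<partial>lborel)"
      using reflect[of "\<lambda>y. ?f (x + y)"] by simp
    also have "\<dots> = emeasure lborel A" by (subst shift_lborel) auto
    finally show "(\<integral>\<^sup>+y. ?f (x - y) * ?g x \<partial>lborel) = emeasure lborel A * ?g x"
      by (subst nn_integral_multc) auto
  qed
  also have "\<dots> = emeasure lborel A * emeasure lborel ?U"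
    by (simp add: nn_integral_cmult sets_M ball)
  finally show "emeasure M A = emeasure lborel A"
    using emeasure_lborel_unit_cball[where 'a = 'a]
    by (metis ennreal_mult_divide_eq infinity_ennreal_def)
qed (simp add: sets_M)

text \<open>The image measure is again translation invariant, because
  \<open>c + T y = T (b + y)\<close> when \<open>T b = c\<close>. Moreover \<open>T\<close>
  preserves every ball about 0, which fixes the normalisation and gives sigma-finiteness.\<close>

lemma distr_lborel_orthogonal_transformation:
  fixes T :: "'a::euclidean_space \<Rightarrow> 'a"
  assumes T: "orthogonal_transformation T"
  shows "distr lborel borel T = lborel"
proof (rule translation_invariant_eq_lborel)
  have lin: "linear T" using T by (rule orthogonal_transformation_linear)
  have meas [measurable]: "T \<in> borel_measurable borel"
    using linear_continuous_on[OF linear_conv_bounded_linear[THEN iffD1, OF lin], of UNIV]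
    by (rule borel_measurable_continuous_onI)
  have pre: "T -` cball 0 r = cball 0 r" for r
    using T by (auto simp: orthogonal_transformation_norm)
  show "sets (distr lborel borel T) = sets borel" by simp
  show "emeasure (distr lborel borel T) (cball 0 1) = emeasure lborel (cball (0::'a) 1)"
    by (simp add: emeasure_distr pre)
  show "distr (distr lborel borel T) borel ((+) c) = distr lborel borel T" for c
  proof -
    obtain b where b: "T b = c"
      using orthogonal_transformation_surj[OF T] by (metis surjD)
    have "distr (distr lborel borel T) borel ((+) c) = distr (distr lborel borel ((+) b)) borel T"
      by (simp add: distr_distr comp_def linear_add[OF lin] b)
    then show ?thesis by (simp add: lborel_distr_plus)
  qed
  show "sigma_finite_measure (distr lborel borel T)"
  proof
    show "\<exists>A. countable A \<and> A \<subseteq> sets (distr lborel borel T) \<and>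
      \<Union>A = space (distr lborel borel T) \<and> (\<forall>a\<in>A. emeasure (distr lborel borel T) a \<noteq> \<infinity>)"
    proof (intro exI[of _ "range (\<lambda>n::nat. cball 0 (real n))"] conjI ballI)
      show "\<Union> (range (\<lambda>n::nat. cball 0 (real n))) = space (distr lborel borel T)"
        using real_arch_simple by auto
    qed (auto simp: emeasure_distr pre emeasure_lborel_cball_finite[THEN less_imp_neq, simplified])
  qed
qed

section \<open>Volume of the double cone by slicing\<close>

text \<open>Radius 0 is covered because the slices of the cone collapse to a point at
  \<open>\<bar>t\<bar> = 1\<close> and, when \<open>0 < a\<close>, at \<open>t = 0\<close>. As
  \<open>A\<close> is nonempty, the point has measure 0, in agreement with the formula.\<close>

lemma emeasure_PiM_lborel_cball:
  assumes "finite A" "A \<noteq> {}" "r \<ge> 0"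
  shows "emeasure (\<Pi>\<^sub>M i\<in>A. lborel) ({z. sqrt (\<Sum>i\<in>A. (z i)\<^sup>2) \<le> r} \<inter> space (\<Pi>\<^sub>M i\<in>A. lborel)) =
    ennreal (unit_ball_vol (card A) * r ^ card A)"
proof (cases "r = 0")
  case True
  interpret product_sigma_finite "\<lambda>_::'a. lborel :: real measure" by standard
  have "{z. sqrt (\<Sum>i\<in>A. (z i)\<^sup>2) \<le> r} \<inter> space (\<Pi>\<^sub>M i\<in>A. lborel) = (\<Pi>\<^sub>E i\<in>A. {0::real})"
  proof -
    have "sqrt (\<Sum>i\<in>A. (z i)\<^sup>2) \<le> 0 \<longleftrightarrow> (\<forall>i\<in>A. z i = 0)" for z :: "'a \<Rightarrow> real"
    proof -
      have "sqrt (\<Sum>i\<in>A. (z i)\<^sup>2) \<le> 0 \<longleftrightarrow> (\<Sum>i\<in>A. (z i)\<^sup>2) = 0"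
        using sum_nonneg[of A "\<lambda>i. (z i)\<^sup>2"] by auto
      then show ?thesis using \<open>finite A\<close> by (simp add: sum_nonneg_eq_0_iff)
    qed
    then show ?thesis using True by (auto simp: space_PiM PiE_iff extensional_def restrict_def fun_eq_iff)
  qed
  also have "emeasure (\<Pi>\<^sub>M i\<in>A. lborel) \<dots> = 0"
    using assms(1,2) by (subst emeasure_PiM) (auto simp: power_0_left)
  finally show ?thesis using True assms(1,2) by (simp add: power_0_left)
next
  case False
  then show ?thesis using assms by (intro emeasure_cball_aux) auto
qed

text \<open>The slice of the cone \<open>a * norm y \<le> \<bar>y \<bullet> b\<bar>\<close>, \<open>norm y \<le> 1\<close>, at \<open>y \<bullet> b = t\<close> is bounded by the
  lateral surface of the cone for \<open>\<bar>t\<bar> < a\<close> and by the unit sphere otherwise.\<close>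

definition cone_slice_radius :: "real \<Rightarrow> real \<Rightarrow> real" where
  "cone_slice_radius a t = (if \<bar>t\<bar> < a then \<bar>t\<bar> * (sqrt (1 - a\<^sup>2) / a) else sqrt (1 - t\<^sup>2))"

lemma cone_slice_radius_nonneg: "0 \<le> a \<Longrightarrow> a \<le> 1 \<Longrightarrow> \<bar>t\<bar> \<le> 1 \<Longrightarrow> 0 \<le> cone_slice_radius a t"
  by (simp add: cone_slice_radius_def abs_square_le_1)

text \<open>Here \<open>t\<close> is the axial coordinate and \<open>w\<close> the squared length of
  the remaining ones. For \<open>\<bar>t\<bar> < a\<close> the cone condition forces the ball
  condition, otherwise the ball condition forces the cone condition, so a single bound on
  \<open>sqrt w\<close> survives in each range.\<close>

lemma cone_slice_iff:
  fixes a t w :: real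
  assumes "0 \<le> a" "a \<le> 1" "0 \<le> w"
  shows "sqrt (t\<^sup>2 + w) \<le> 1 \<and> a * sqrt (t\<^sup>2 + w) \<le> \<bar>t\<bar> \<longleftrightarrow>
    \<bar>t\<bar> \<le> 1 \<and> sqrt w \<le> cone_slice_radius a t"
proof (cases "\<bar>t\<bar> < a")
  case True
  then have a: "a > 0" by linarith
  have "a\<^sup>2 \<le> 1" using assms by (simp add: power_le_one)
  have "a * sqrt (t\<^sup>2 + w) \<le> \<bar>t\<bar> \<longleftrightarrow> sqrt (a\<^sup>2 * (t\<^sup>2 + w)) \<le> sqrt (t\<^sup>2)"
    using a by (simp add: real_sqrt_mult)
  also have "\<dots> \<longleftrightarrow> w \<le> t\<^sup>2 * ((1 - a\<^sup>2) / a\<^sup>2)"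
    unfolding real_sqrt_le_iff using a by (simp add: field_simps)
  also have "\<dots> \<longleftrightarrow> sqrt w \<le> sqrt (t\<^sup>2 * ((1 - a\<^sup>2) / a\<^sup>2))"
    by simp
  also have "sqrt (t\<^sup>2 * ((1 - a\<^sup>2) / a\<^sup>2)) = cone_slice_radius a t"
    using True a by (simp add: cone_slice_radius_def real_sqrt_mult real_sqrt_divide)
  finally have eq: "a * sqrt (t\<^sup>2 + w) \<le> \<bar>t\<bar> \<longleftrightarrow> sqrt w \<le> cone_slice_radius a t" .
  have "sqrt (t\<^sup>2 + w) \<le> 1" if "a * sqrt (t\<^sup>2 + w) \<le> \<bar>t\<bar>"
  proof -
    have "a * sqrt (t\<^sup>2 + w) \<le> a * 1" using that True by simp
    then show ?thesis using a by (simp only: mult_le_cancel_left_pos)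
  qed
  then show ?thesis using eq True assms by auto
next
  case False
  have "a * sqrt (t\<^sup>2 + w) \<le> \<bar>t\<bar>" if "sqrt (t\<^sup>2 + w) \<le> 1"
    using mult_left_mono[OF that \<open>0 \<le> a\<close>] False by simp
  moreover have "sqrt (t\<^sup>2 + w) \<le> 1 \<longleftrightarrow> sqrt w \<le> cone_slice_radius a t"
    using False by (auto simp: cone_slice_radius_def)
  moreover have "\<bar>t\<bar> \<le> 1" if "sqrt (t\<^sup>2 + w) \<le> 1"
  proof -
    have "t\<^sup>2 \<le> 1" using that \<open>0 \<le> w\<close> by simp
    then show ?thesis by (simp add: abs_square_le_1)
  qed
  ultimately show ?thesis by blast
qed

text \<open>\<open>lborel\<close> is the image of a product of one-dimensional measures, so Fubini
  can single out the coordinate along \<open>b\<close>. By \<open>cone_slice_iff\<close> the other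
  \<open>n\<close> coordinates fill a ball, whose volume \<open>emeasure_PiM_lborel_cball\<close>
  supplies.\<close>

lemma emeasure_cone:
  fixes b :: "'a::euclidean_space" and a :: real
  assumes b: "b \<in> Basis" and dim: "DIM('a) = Suc n" "n \<ge> 1" and a: "0 \<le> a" "a \<le> 1"
  shows "emeasure lborel {y \<in> cball 0 1. a * norm y \<le> \<bar>y \<bullet> b\<bar>} =
    (\<integral>\<^sup>+t. indicator {-1..1} t * ennreal (unit_ball_vol n * cone_slice_radius a t ^ n) \<partial>lborel)"
proof -
  interpret product_sigma_finite "\<lambda>_::'a. lborel :: real measure" by standard
  let ?B = "Basis - {b}"
  let ?P = "\<lambda>I::'a set. \<Pi>\<^sub>M i\<in>I. (lborel :: real measure)"
  let ?S = "{y \<in> cball 0 1. a * norm y \<le> \<bar>y \<bullet> b\<bar>}"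
  let ?n = "\<lambda>z :: 'a \<Rightarrow> real. sqrt (\<Sum>i\<in>insert b ?B. (z i)\<^sup>2)"
  let ?C = "{z. ?n z \<le> 1 \<and> a * ?n z \<le> \<bar>z b\<bar>} \<inter> space (?P (insert b ?B))"
  have ins: "insert b ?B = Basis" using b by blast
  have fin: "finite ?B" "b \<notin> ?B" by auto
  have card: "card ?B = n" using b dim by simp
  then have ne: "?B \<noteq> {}" by (metis card.empty dim(2) not_one_le_zero)
  have comp: "(\<lambda>z. z i) \<in> borel_measurable (?P (insert b ?B))" if "i \<in> insert b ?B" for i
    using measurable_component_singleton[OF that, of "\<lambda>_. lborel"] by simp
  have norm_meas: "?n \<in> borel_measurable (?P (insert b ?B))"
    by (intro measurable_compose[OF _ borel_measurable_sqrt] borel_measurable_sum borel_measurable_power comp)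
  have "?C = {z \<in> space (?P (insert b ?B)). ?n z \<le> 1} \<inter>
      {z \<in> space (?P (insert b ?B)). a * ?n z \<le> \<bar>z b\<bar>}"
    by blast
  also have "\<dots> \<in> sets (?P (insert b ?B))"
    by (intro sets.Int borel_measurable_le borel_measurable_times borel_measurable_abs
      borel_measurable_const norm_meas comp) simp
  finally have meas_C: "?C \<in> sets (?P (insert b ?B))" .
  have meas_S: "?S \<in> sets borel" by measurable
  have "emeasure lborel ?S =
    emeasure (distr (?P Basis) borel (\<lambda>z. \<Sum>i\<in>Basis. z i *\<^sub>R i)) ?S"
    by (subst lborel_eq) (rule refl)
  also have "\<dots> = emeasure (?P Basis) ((\<lambda>z. \<Sum>i\<in>Basis. z i *\<^sub>R i) -` ?S \<inter> space (?P Basis))"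
    using meas_S by (subst emeasure_distr) auto
  also have "(\<lambda>z. \<Sum>i\<in>Basis. z i *\<^sub>R i) -` ?S \<inter> space (?P Basis) = ?C"
  proof -
    have "norm (\<Sum>i\<in>Basis. z i *\<^sub>R i) = ?n z" for z :: "'a \<Rightarrow> real"
    proof -
      have "norm (\<Sum>i\<in>Basis. z i *\<^sub>R i) = dist 0 (\<Sum>i\<in>Basis. z i *\<^sub>R i :: 'a)" by simp
      also have "\<dots> = ?n z" unfolding ins by (subst euclidean_dist_l2) (simp add: L2_set_def)
      finally show ?thesis .
    qed
    moreover have "(\<Sum>i\<in>Basis. z i *\<^sub>R i) \<bullet> b = z b" for z
      using b by simp
    ultimately show ?thesis by (simp add: vimage_def ins del: insert_Diff_single)
  qed
  also have "emeasure (?P Basis) ?C = (\<integral>\<^sup>+z. indicator ?C z \<partial>?P (insert b ?B))"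
    using meas_C unfolding ins by (subst nn_integral_indicator) auto
  also have "\<dots> = (\<integral>\<^sup>+t. \<integral>\<^sup>+z. indicator ?C (z(b := t)) \<partial>?P ?B \<partial>lborel)"
    by (rule product_nn_integral_insert_rev[OF fin]) (rule borel_measurable_indicator[OF meas_C])
  also have "\<dots> = (\<integral>\<^sup>+t. \<integral>\<^sup>+z. indicator {-1..1} t *
      indicator ({z. sqrt (\<Sum>i\<in>?B. (z i)\<^sup>2) \<le> cone_slice_radius a t} \<inter> space (?P ?B)) z
      \<partial>?P ?B \<partial>lborel)"
  proof (intro nn_integral_cong)
    fix t :: real and z assume z: "z \<in> space (?P ?B)"
    have "(\<Sum>i\<in>insert b ?B. ((z(b := t)) i)\<^sup>2) = t\<^sup>2 + (\<Sum>i\<in>?B. (z i)\<^sup>2)"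
      by (simp add: sum.insert[OF fin] del: insert_Diff_single)
    moreover have "z(b := t) \<in> space (?P (insert b ?B))"
      using z by (auto simp: space_PiM PiE_def extensional_def)
    ultimately have "z(b := t) \<in> ?C \<longleftrightarrow> t \<in> {-1..1} \<and> sqrt (\<Sum>i\<in>?B. (z i)\<^sup>2) \<le> cone_slice_radius a t"
      using cone_slice_iff[OF a, of "\<Sum>i\<in>?B. (z i)\<^sup>2" t]
      by (auto simp: sum_nonneg abs_le_iff simp del: insert_Diff_single)
    then show "indicator ?C (z(b := t)) = indicator {-1..1} t *
      (indicator ({z. sqrt (\<Sum>i\<in>?B. (z i)\<^sup>2) \<le> cone_slice_radius a t} \<inter> space (?P ?B)) z :: ennreal)"
      using z by (auto simp: indicator_def)
  qed
  also have "\<dots> = (\<integral>\<^sup>+t. indicator {-1..1} t * emeasure (?P ?B)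
      ({z. sqrt (\<Sum>i\<in>?B. (z i)\<^sup>2) \<le> cone_slice_radius a t} \<inter> space (?P ?B)) \<partial>lborel)"
    by (intro nn_integral_cong) (subst nn_integral_cmult_indicator, auto)
  also have "\<dots> = (\<integral>\<^sup>+t. indicator {-1..1} t * ennreal (unit_ball_vol n * cone_slice_radius a t ^ n) \<partial>lborel)"
  proof (intro nn_integral_cong)
    fix t :: real
    show "indicator {-1..1} t * emeasure (?P ?B)
      ({z. sqrt (\<Sum>i\<in>?B. (z i)\<^sup>2) \<le> cone_slice_radius a t} \<inter> space (?P ?B)) =
      indicator {-1..1} t * ennreal (unit_ball_vol n * cone_slice_radius a t ^ n)"
    \<comment> \<open>For \<open>\<bar>t\<bar> > 1\<close> the radius is \<open>sqrt\<close> of a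
      negative number, which is negative by convention; the indicator removes these
      \<open>t\<close>.\<close>
    proof (cases "t \<in> {-1..1}")
      case True
      then have "0 \<le> cone_slice_radius a t" using a by (intro cone_slice_radius_nonneg) auto
      then show ?thesis using emeasure_PiM_lborel_cball[OF fin(1) ne] by (simp add: card)
    qed simp
  qed
  finally show ?thesis .
qed

section \<open>The one-dimensional integrals\<close>

text \<open>The radius is even in \<open>t\<close>, so \<open>{0..1}\<close> counts twice; it is
  linear up to \<open>a\<close>, and \<open>{a..1}\<close> contributes \<open>I\<close>. The value
  \<open>I\<close> stays unevaluated because it reappears in the integral of the density, with which
  this one is compared.\<close>

lemma has_integral_cone_slice_radius_power:
  assumes a: "0 \<le> a" "a \<le> 1"
    and I: "((\<lambda>t. sqrt (1 - t\<^sup>2) ^ n) has_integral I) {a..1}"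
  shows "((\<lambda>t. cone_slice_radius a t ^ n) has_integral
    2 * (a * sqrt (1 - a\<^sup>2) ^ n / real (Suc n) + I)) {-1..1}"
proof -
  let ?k = "sqrt (1 - a\<^sup>2) / a"
  have "((\<lambda>t. t ^ n * ?k ^ n) has_integral (a ^ Suc n / real (Suc n) - 0 ^ Suc n / real (Suc n)) * ?k ^ n) {0..a}"
  proof (intro has_integral_mult_left fundamental_theorem_of_calculus a)
    fix t :: real
    have "((\<lambda>t. t ^ Suc n / real (Suc n)) has_real_derivative t ^ n) (at t within {0..a})"
      using DERIV_cdivide[OF DERIV_pow[of "Suc n" t "{0..a}"], of "real (Suc n)"] by simp
    then show "((\<lambda>t. t ^ Suc n / real (Suc n)) has_vector_derivative t ^ n) (at t within {0..a})"
      by (simp only: has_real_derivative_iff_has_vector_derivative)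
  qed
  \<comment> \<open>At \<open>a = 0\<close> the slope \<open>?k\<close> is a division by zero, hence
    0, and both sides vanish.\<close>
  also have "(a ^ Suc n / real (Suc n) - 0 ^ Suc n / real (Suc n)) * ?k ^ n =
    a * sqrt (1 - a\<^sup>2) ^ n / real (Suc n)"
    using a by (cases "a = 0") (auto simp: power_divide)
  finally have "((\<lambda>t. t ^ n * ?k ^ n) has_integral a * sqrt (1 - a\<^sup>2) ^ n / real (Suc n)) {0..a}" .
  \<comment> \<open>At \<open>t = a\<close> the radius takes its other branch, whose value can
    differ if \<open>a = 0\<close>; this point is discarded as a null set.\<close>
  then have "((\<lambda>t. cone_slice_radius a t ^ n) has_integral a * sqrt (1 - a\<^sup>2) ^ n / real (Suc n)) {0..a}"
    by (rule has_integral_spike[of "{a}", rotated 2])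
      (auto simp: cone_slice_radius_def power_mult_distrib power_divide)
  moreover have "((\<lambda>t. cone_slice_radius a t ^ n) has_integral I) {a..1}"
    by (rule has_integral_eq[OF _ I]) (use a in \<open>auto simp: cone_slice_radius_def\<close>)
  ultimately have half: "((\<lambda>t. cone_slice_radius a t ^ n) has_integral
      a * sqrt (1 - a\<^sup>2) ^ n / real (Suc n) + I) {0..1}"
    using a by (intro has_integral_combine[of 0 a 1])
  have "cone_slice_radius a (- t) = cone_slice_radius a t" for t
    by (simp add: cone_slice_radius_def)
  then have "((\<lambda>t. cone_slice_radius a t ^ n) has_integral
      a * sqrt (1 - a\<^sup>2) ^ n / real (Suc n) + I) {-1..0}"
    using half has_integral_reflect_real[of "\<lambda>t. cone_slice_radius a t ^ n" _ 1 0] by simp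
  then show ?thesis
    unfolding mult_2 by (rule has_integral_combine[OF _ _ _ half, rotated 2]) simp_all
qed

text \<open>The fundamental theorem of calculus for \<open>t (1 - t\<^sup>2)\<^bsup>n/2\<^esup>\<close>.\<close>

lemma has_integral_one_minus_square_powr:
  assumes a: "0 \<le> a" "a \<le> 1" and "n \<ge> 2"
    and I: "((\<lambda>t. sqrt (1 - t\<^sup>2) ^ n) has_integral I) {a..1}"
  shows "((\<lambda>t. (1 - t\<^sup>2) powr ((real n - 2) / 2)) has_integral
    real (Suc n) / real n * (a * sqrt (1 - a\<^sup>2) ^ n / real (Suc n) + I)) {a..1}"
proof -
  let ?\<phi> = "\<lambda>t::real. t * sqrt (1 - t\<^sup>2) ^ n"
  let ?\<psi> = "\<lambda>t::real. (1 - t\<^sup>2) powr ((real n - 2) / 2)"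
  let ?\<phi>' = "\<lambda>t::real. real (Suc n) * sqrt (1 - t\<^sup>2) ^ n - real n * ?\<psi> t"
  have "(?\<phi>' has_integral (?\<phi> 1 - ?\<phi> a)) {a..1}"
  \<comment> \<open>Only the interior is differentiated: \<open>sqrt (1 - t\<^sup>2)\<close> has no
    derivative at 1, and for \<open>n = 2\<close> the convention \<open>0 powr 0 = 0\<close> makes
    \<open>?\<psi> 1\<close> differ from the limit 1.\<close>
  proof (rule fundamental_theorem_of_calculus_interior)
    show "continuous_on {a..1} ?\<phi>" by (intro continuous_intros)
    fix t assume t: "t \<in> {a<..<1}"
    then have "t\<^sup>2 < 1" using a by (simp add: abs_square_less_1)
    obtain m where m: "n = Suc (Suc m)" using \<open>n \<ge> 2\<close> by (metis add_2_eq_Suc le_Suc_ex)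
    have \<psi>: "?\<psi> t = sqrt (1 - t\<^sup>2) ^ m"
    proof -
      have "?\<psi> t = ((1 - t\<^sup>2) powr (1 / 2)) powr real m"
        by (simp add: powr_powr m)
      also have "\<dots> = sqrt (1 - t\<^sup>2) powr real m"
        using \<open>t\<^sup>2 < 1\<close> by (simp add: powr_half_sqrt)
      also have "\<dots> = sqrt (1 - t\<^sup>2) ^ m"
        using \<open>t\<^sup>2 < 1\<close> by (intro powr_realpow) simp
      finally show ?thesis .
    qed
    have sq: "sqrt (1 - t\<^sup>2) * sqrt (1 - t\<^sup>2) = 1 - t\<^sup>2" using \<open>t\<^sup>2 < 1\<close> by simp
    have "((\<lambda>t. 1 - t\<^sup>2) has_real_derivative - (2 * t)) (at t)"
      by (auto intro!: derivative_eq_intros)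
    then have "((\<lambda>t. sqrt (1 - t\<^sup>2)) has_real_derivative
        inverse (sqrt (1 - t\<^sup>2)) / 2 * - (2 * t)) (at t)"
      using \<open>t\<^sup>2 < 1\<close> by (intro DERIV_chain2[where f = sqrt and g = "\<lambda>t. 1 - t\<^sup>2", OF DERIV_real_sqrt]) simp_all
    moreover have "inverse s / 2 * - (2 * t) = - t / s" for s :: real
      by (simp add: inverse_eq_divide)
    ultimately have "((\<lambda>t. sqrt (1 - t\<^sup>2)) has_real_derivative - t / sqrt (1 - t\<^sup>2)) (at t)"
      by (simp only:)
    from DERIV_mult[OF DERIV_ident DERIV_power[OF this, of n]]
    have "(?\<phi> has_real_derivative 1 * sqrt (1 - t\<^sup>2) ^ n +
        real n * (- t / sqrt (1 - t\<^sup>2) * sqrt (1 - t\<^sup>2) ^ (n - Suc 0)) * t) (at t)"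
      .
    also have "1 * sqrt (1 - t\<^sup>2) ^ n +
        real n * (- t / sqrt (1 - t\<^sup>2) * sqrt (1 - t\<^sup>2) ^ (n - Suc 0)) * t =
      sqrt (1 - t\<^sup>2) ^ n - real n * (t\<^sup>2 * sqrt (1 - t\<^sup>2) ^ m)"
    proof -
      have "1 * x + k * (- t / s * (s * y)) * t = x - k * (t\<^sup>2 * y)" if "s \<noteq> 0" for x k s y :: real
        using that by (simp add: power2_eq_square)
      moreover have "sqrt (1 - t\<^sup>2) ^ (n - Suc 0) = sqrt (1 - t\<^sup>2) * sqrt (1 - t\<^sup>2) ^ m"
        by (simp add: m)
      moreover have "sqrt (1 - t\<^sup>2) \<noteq> 0" using \<open>t\<^sup>2 < 1\<close> by simp
      ultimately show ?thesis by (simp add: power2_eq_square)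
    qed
    \<comment> \<open>Splitting \<open>t\<^sup>2\<close> as \<open>1 - (1 - t\<^sup>2)\<close>
      isolates \<open>?\<psi> t\<close>; the other part joins the first term of the product rule and
      raises its coefficient to \<open>Suc n\<close>.\<close>
    also have "t\<^sup>2 * sqrt (1 - t\<^sup>2) ^ m = ?\<psi> t - sqrt (1 - t\<^sup>2) ^ n"
    proof -
      have "sqrt (1 - t\<^sup>2) ^ n = (1 - t\<^sup>2) * sqrt (1 - t\<^sup>2) ^ m"
        by (simp only: m power_Suc mult.assoc[symmetric] sq)
      then show ?thesis by (simp add: \<psi> algebra_simps)
    qed
    also have "sqrt (1 - t\<^sup>2) ^ n - real n * (?\<psi> t - sqrt (1 - t\<^sup>2) ^ n) = ?\<phi>' t"
      by (simp add: algebra_simps)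
    finally show "(?\<phi> has_vector_derivative ?\<phi>' t) (at t)"
      by (simp only: has_real_derivative_iff_has_vector_derivative)
  qed (use a in simp)
  \<comment> \<open>Solving the derivative formula for \<open>?\<psi>\<close> expresses its integral
    through \<open>I\<close> and the boundary values of \<open>?\<phi>\<close>, of which the one at
    1 is zero.\<close>
  from has_integral_divide[OF has_integral_diff[OF has_integral_mult_right[OF I, of "real (Suc n)"] this], of "real n"]
  have "((\<lambda>t. (real (Suc n) * sqrt (1 - t\<^sup>2) ^ n - ?\<phi>' t) / real n) has_integral
      (real (Suc n) * I - (?\<phi> 1 - ?\<phi> a)) / real n) {a..1}"
    .
  moreover have "(real (Suc n) * sqrt (1 - t\<^sup>2) ^ n - ?\<phi>' t) / real n = ?\<psi> t" for t
    using \<open>n \<ge> 2\<close> by simp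
  moreover have "(real (Suc n) * I - (?\<phi> 1 - ?\<phi> a)) / real n =
    real (Suc n) / real n * (a * sqrt (1 - a\<^sup>2) ^ n / real (Suc n) + I)"
    using \<open>n \<ge> 2\<close> by (simp add: field_simps power_0_left del: of_nat_Suc)
  ultimately show ?thesis by (simp only:)
qed

section \<open>Matching the normalising constants\<close>

text \<open>The recursion of Gamma lowers the arguments in both ball volumes to those occurring in
  \<open>slicing_const\<close>, after which the Gamma value at \<open>real (Suc n) / 2\<close>
  cancels.\<close>

lemma slicing_const_eq_unit_ball_vol:
  assumes "n \<ge> 1"
  shows "slicing_const (Suc n) * unit_ball_vol (Suc n) = 2 * real n / real (Suc n) * unit_ball_vol n"
proof -
  have g1: "Gamma (real (Suc n) / 2 + 1) = real (Suc n) / 2 * Gamma (real (Suc n) / 2)"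
    by (rule Gamma_plus1) auto
  have g2: "Gamma (real n / 2 + 1) = real n / 2 * Gamma (real n / 2)"
    using assms by (intro Gamma_plus1) auto
  have pos: "Gamma (real (Suc n) / 2) > 0" "Gamma (real n / 2) > 0"
    using assms by (auto intro!: Gamma_real_pos)
  have "pi powr (real (Suc n) / 2) = pi powr (real n / 2) * sqrt pi"
    by (simp add: add_divide_distrib powr_add powr_half_sqrt)
  moreover have "(real (Suc n) - 1) / 2 = real n / 2" by simp
  ultimately have "slicing_const (Suc n) * unit_ball_vol (Suc n) =
    2 * Gamma (real (Suc n) / 2) / (sqrt pi * Gamma (real n / 2)) *
    (pi powr (real n / 2) * sqrt pi / (real (Suc n) / 2 * Gamma (real (Suc n) / 2)))"
    by (simp only: slicing_const_def unit_ball_vol_def g1)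
  also have "\<dots> = 2 * real n / real (Suc n) * (pi powr (real n / 2) / (real n / 2 * Gamma (real n / 2)))"
  proof -
    \<comment> \<open>Stated for free variables, so that the Gamma values and the powers of
      \<open>pi\<close> stay opaque to the simplifier.\<close>
    have "2 * x / (s * y) * (p * s / (k / 2 * x)) = 2 * l / k * (p / (l / 2 * y))"
      if "x \<noteq> 0" "y \<noteq> 0" "s \<noteq> 0" "k \<noteq> 0" "l \<noteq> 0" for x y s p k l :: real
      using that by (simp add: field_simps)
    note alg = this
    show ?thesis
    proof (rule alg)
      show "Gamma (real (Suc n) / 2) \<noteq> 0" using pos(1) by (rule less_imp_neq[THEN not_sym])
      show "Gamma (real n / 2) \<noteq> 0" using pos(2) by (rule less_imp_neq[THEN not_sym])
    qed (use assms in simp_all)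
  qed
  finally show ?thesis by (simp only: unit_ball_vol_def g2)
qed

lemma slicing_density_nonneg:
  assumes "d \<ge> 2"
  shows "0 \<le> slicing_density d t"
proof -
  have "0 < Gamma (real d / 2)" "0 < Gamma ((real d - 1) / 2)"
    using assms by (auto intro!: Gamma_real_pos)
  then have "0 \<le> slicing_const d"
    unfolding slicing_const_def
    by (intro divide_nonneg_nonneg mult_nonneg_nonneg less_imp_le[of 0 "Gamma _"]) auto
  then show ?thesis by (simp add: slicing_density_def)
qed

text \<open>With \<open>n = d - 1\<close>, the cone volume and the integral of the density are
  explicit multiples of the same \<open>J\<close>. By \<open>slicing_const_eq_unit_ball_vol\<close>
  the two factors differ exactly by the volume of the unit ball.\<close>

lemma emeasure_cone_eq_nn_integral_slicing_density:
  fixes b :: "'a::euclidean_space" and a :: real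
  assumes b: "b \<in> Basis" and dim: "DIM('a) = d" "d \<ge> 3" and a: "0 \<le> a" "a \<le> 1"
  shows "emeasure lborel {y \<in> cball 0 1. a * norm y \<le> \<bar>y \<bullet> b\<bar>} =
    emeasure lborel (cball (0::'a) 1) * (\<integral>\<^sup>+t. ennreal (slicing_density d t) * indicator {a..1} t \<partial>lborel)"
proof -
  obtain n where n: "d = Suc n" "n \<ge> 2" using \<open>d \<ge> 3\<close> by (cases d) auto
  have "(\<lambda>t. sqrt (1 - t\<^sup>2) ^ n) integrable_on {a..1}"
    by (intro integrable_continuous_interval continuous_intros)
  then obtain I where I: "((\<lambda>t. sqrt (1 - t\<^sup>2) ^ n) has_integral I) {a..1}" by blast
  define J where "J = a * sqrt (1 - a\<^sup>2) ^ n / real (Suc n) + I"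
  have slice: "((\<lambda>t. unit_ball_vol n * cone_slice_radius a t ^ n) has_integral unit_ball_vol n * (2 * J)) {-1..1}"
    unfolding J_def by (intro has_integral_mult_right has_integral_cone_slice_radius_power a I)
  have "((\<lambda>t. slicing_const d * (1 - t\<^sup>2) powr ((real n - 2) / 2)) has_integral
      slicing_const d * (real (Suc n) / real n * J)) {a..1}"
    unfolding J_def by (intro has_integral_mult_right has_integral_one_minus_square_powr a n I)
  then have dens: "(slicing_density d has_integral slicing_const d * (real (Suc n) / real n * J)) {a..1}"
    by (simp add: slicing_density_def[abs_def] n)
  have "emeasure lborel {y \<in> cball 0 1. a * norm y \<le> \<bar>y \<bullet> b\<bar>} =
    (\<integral>\<^sup>+t. ennreal (unit_ball_vol n * cone_slice_radius a t ^ n) * indicator {-1..1} t \<partial>lborel)"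
    using emeasure_cone[OF b _ _ a, of n] n dim by (simp add: mult.commute)
  also have "\<dots> = ennreal (unit_ball_vol n * (2 * J))"
    using a by (intro nn_integral_has_integral_lebesgue'[OF _ slice])
      (auto intro!: mult_nonneg_nonneg zero_le_power cone_slice_radius_nonneg)
  also have "unit_ball_vol n * (2 * J) = unit_ball_vol d * (slicing_const d * (real (Suc n) / real n * J))"
  proof -
    have "unit_ball_vol d * (slicing_const d * (real (Suc n) / real n * J)) =
        (slicing_const d * unit_ball_vol d) * (real (Suc n) / real n * J)"
      by (simp only: mult_ac)
    also have "slicing_const d * unit_ball_vol d = 2 * real n / real (Suc n) * unit_ball_vol n"
      using slicing_const_eq_unit_ball_vol[of n] n by simp
    also have "\<dots> * (real (Suc n) / real n * J) = unit_ball_vol n * (2 * J)"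
      using n by (simp del: of_nat_Suc)
    finally show ?thesis by simp
  qed
  also have "ennreal \<dots> = ennreal (unit_ball_vol d) * ennreal (slicing_const d * (real (Suc n) / real n * J))"
    by (rule ennreal_mult') simp
  also have "ennreal (unit_ball_vol d) = emeasure lborel (cball (0::'a) 1)"
    by (simp add: emeasure_cball dim)
  also have "ennreal (slicing_const d * (real (Suc n) / real n * J)) =
      (\<integral>\<^sup>+t. ennreal (slicing_density d t) * indicator {a..1} t \<partial>lborel)"
    using dim by (intro nn_integral_has_integral_lebesgue'[OF _ dens, symmetric] slicing_density_nonneg) simp
  finally show ?thesis .
qed

section \<open>Law of the absolute inner product on the sphere\<close>

lemma measurable_slicing_density [measurable]: "slicing_density d \<in> borel_measurable borel"
  unfolding slicing_density_def[abs_def] by measurable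

lemma measurable_abs_inner_unif_sphere [measurable]:
  "(\<lambda>\<xi>. \<bar>\<xi> \<bullet> u\<bar>) \<in> borel_measurable (unif_sphere :: 'a::euclidean_space measure)"
proof -
  have "(\<lambda>\<xi>. \<bar>\<xi> \<bullet> u\<bar>) \<in> borel_measurable (restrict_space borel (sphere 0 1))"
    by (rule measurable_restrict_space1) measurable
  then show ?thesis
    by (simp only: measurable_cong_sets[OF sets_unif_sphere refl])
qed

text \<open>Away from 0, the inequality defining the cone depends only on the direction of
  \<open>y\<close>, so the cone measure of \<open>?A\<close> is the relative volume of the double
  cone \<open>?S u\<close>. An orthogonal map moves its axis to a coordinate axis without changing
  the volume.\<close>

lemma emeasure_distr_abs_inner_atLeast:
  fixes u :: "real ^ 'n"
  assumes u: "norm u = 1" and d: "CARD('n) = d" "d \<ge> 3" and a: "0 \<le> a" "a \<le> 1"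
  shows "emeasure (distr unif_sphere borel (\<lambda>\<xi>. \<bar>\<xi> \<bullet> u\<bar>)) {a..} =
    (\<integral>\<^sup>+t. ennreal (slicing_density d t) * indicator {a..1} t \<partial>lborel)"
proof -
  let ?S = "\<lambda>v :: real ^ 'n. {y \<in> cball 0 1. a * norm y \<le> \<bar>y \<bullet> v\<bar>}"
  let ?A = "{\<xi> \<in> sphere 0 1. a \<le> \<bar>\<xi> \<bullet> u\<bar>}"
  have meas_S: "?S v \<in> sets borel" for v by measurable
  have meas_A: "?A \<in> sets borel" by measurable
  \<comment> \<open>Any coordinate can serve as the axis.\<close>
  obtain k :: 'n where True by simp
  let ?b = "axis k 1 :: real ^ 'n"
  obtain T :: "real ^ 'n \<Rightarrow> real ^ 'n" where T: "orthogonal_transformation T" "T ?b = u"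
    using orthogonal_transformation_exists_1[of ?b u] u by (auto simp: norm_axis_1)
  have "\<bar>y \<bullet> ?b\<bar> = \<bar>T y \<bullet> u\<bar>" for y
    using T by (metis orthogonal_transformation_def)
  then have pre: "T -` ?S u = ?S ?b"
    using orthogonal_transformation_norm[OF T(1)] by auto
  have meas_T: "T \<in> borel_measurable borel"
    using linear_continuous_on[OF linear_conv_bounded_linear[THEN iffD1,
      OF orthogonal_transformation_linear[OF T(1)]], of UNIV]
    by (rule borel_measurable_continuous_onI)
  have "emeasure (distr unif_sphere borel (\<lambda>\<xi>. \<bar>\<xi> \<bullet> u\<bar>)) {a..} = emeasure unif_sphere ?A"
    by (subst emeasure_distr) (auto simp: space_unif_sphere intro!: arg_cong[where f = "emeasure _"])
  also have "\<dots> = emeasure lborel (cball 0 1 \<inter> sgn -` ?A) / emeasure lborel (cball (0 :: real ^ 'n) 1)"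
    using meas_A by (rule emeasure_unif_sphere) auto
  \<comment> \<open>The apex is removed because \<open>sgn 0 = 0\<close> lies off the sphere; a
    single point is a null set.\<close>
  also have "cball 0 1 \<inter> sgn -` ?A = ?S u - {0}"
  proof -
    have "a \<le> \<bar>sgn y \<bullet> u\<bar> \<longleftrightarrow> a * norm y \<le> \<bar>y \<bullet> u\<bar>" if "y \<noteq> 0" for y :: "real ^ 'n"
      using that by (simp add: sgn_div_norm abs_mult field_simps)
    then show ?thesis by (auto simp: norm_sgn)
  qed
  also have "emeasure lborel (?S u - {0}) = emeasure lborel (?S u)"
    using meas_S by (intro emeasure_Diff_null_set) auto
  also have "\<dots> = emeasure (distr lborel borel T) (?S u)"
    by (simp add: distr_lborel_orthogonal_transformation[OF T(1)])
  also have "\<dots> = emeasure lborel (T -` ?S u \<inter> space lborel)"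
    by (rule emeasure_distr) (use meas_S meas_T in simp_all)
  also have "T -` ?S u \<inter> space lborel = ?S ?b"
    by (simp only: pre space_lborel space_borel Int_UNIV_right)
  also have "emeasure lborel (?S ?b) = emeasure lborel (cball (0 :: real ^ 'n) 1) *
      (\<integral>\<^sup>+t. ennreal (slicing_density d t) * indicator {a..1} t \<partial>lborel)"
    using d a by (intro emeasure_cone_eq_nn_integral_slicing_density) (auto simp: axis_in_Basis_iff)
  also have "\<dots> / emeasure lborel (cball (0 :: real ^ 'n) 1) =
      (\<integral>\<^sup>+t. ennreal (slicing_density d t) * indicator {a..1} t \<partial>lborel)"
    using emeasure_lborel_unit_cball[where 'a = "real ^ 'n"]
    by (subst mult.commute) (rule ennreal_mult_divide_eq, auto)
  finally show ?thesis .
qed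

text \<open>The upper rays form an intersection-stable generator of the Borel sets, so agreement on
  them suffices.\<close>

lemma distr_abs_inner_unif_sphere:
  fixes u :: "real ^ 'n"
  assumes u: "norm u = 1" and d: "CARD('n) = d" "d \<ge> 3"
  shows "distr unif_sphere borel (\<lambda>\<xi>. \<bar>\<xi> \<bullet> u\<bar>) =
    density lborel (\<lambda>t. ennreal (indicator {0..1} t * slicing_density d t))" (is "?M = ?D")
proof (rule measure_eqI_generator_eq[where E = "range atLeast" and \<Omega> = UNIV and A = "\<lambda>n. {- real n..}"])
  interpret prob_space "unif_sphere :: (real ^ 'n) measure" by (rule prob_space_unif_sphere)
  interpret M: prob_space ?M by (rule prob_space_distr) measurable
  show "Int_stable (range atLeast :: real set set)"
  proof -
    have "{a..} \<inter> {b..} = {max a b..}" for a b :: real by auto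
    then show ?thesis by (auto simp: Int_stable_def)
  qed
  show "sets ?M = sigma_sets UNIV (range atLeast)" "sets ?D = sigma_sets UNIV (range atLeast)"
    by (simp_all add: borel_Ici)
  show "(\<Union>n. {- real n..}) = UNIV"
  proof (intro set_eqI iffI UNIV_I)
    fix x :: real
    obtain n where "- x \<le> real n" using real_arch_simple by blast
    then show "x \<in> (\<Union>n. {- real n..})" by (auto intro!: exI[of _ n])
  qed
  show "emeasure ?M {- real n..} \<noteq> \<infinity>" for n by simp
  fix X :: "real set" assume "X \<in> range atLeast"
  then obtain a where X: "X = {a..}" by blast
  \<comment> \<open>Neither measure charges the negative numbers, so the ray may start at
    \<open>max 0 a\<close>; if this exceeds 1, both measures of the ray are 0.\<close>
  define a' where "a' = max 0 a"
  have M: "emeasure ?M X = emeasure ?M {a'..}"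
  proof -
    have "(\<lambda>\<xi>. \<bar>\<xi> \<bullet> u\<bar>) -` X = (\<lambda>\<xi>. \<bar>\<xi> \<bullet> u\<bar>) -` {a'..}"
      by (auto simp: X a'_def)
    then show ?thesis by (subst (1 2) emeasure_distr) (simp_all add: X)
  qed
  have D: "emeasure ?D X = (\<integral>\<^sup>+t. ennreal (slicing_density d t) * indicator {a'..1} t \<partial>lborel)"
    by (subst emeasure_density)
      (auto simp: X a'_def indicator_def intro!: nn_integral_cong)
  show "emeasure ?M X = emeasure ?D X"
  proof (cases "a' \<le> 1")
    case True
    then show ?thesis
      unfolding M D using u d by (intro emeasure_distr_abs_inner_atLeast) (auto simp: a'_def)
  next
    case False
    have "\<bar>\<xi> \<bullet> u\<bar> < a'" if "\<xi> \<in> sphere 0 1" for \<xi>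
      using Cauchy_Schwarz_ineq2[of \<xi> u] that u False by simp
    then have "(\<lambda>\<xi>. \<bar>\<xi> \<bullet> u\<bar>) -` {a'..} \<inter> sphere 0 1 = {}" by force
    then have "emeasure ?M {a'..} = 0"
      by (simp add: emeasure_distr space_unif_sphere)
    then show ?thesis unfolding M D using False by simp
  qed
qed auto

section \<open>The slicing operator as an expectation, and the error identity\<close>

lemma slicing_eq_expectation:
  fixes x :: "real ^ 'n"
  assumes d: "CARD('n) = d" "d \<ge> 3" and f: "continuous_on {0..1} f" and x: "norm x \<le> 1"
  shows "(LINT \<xi>|unif_sphere. f \<bar>\<xi> \<bullet> x\<bar>) = slicing d f (norm x)"
proof -
  \<comment> \<open>For \<open>x = 0\<close> any unit vector will do, since it is scaled by
    zero.\<close>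
  obtain u :: "real ^ 'n" where u: "norm u = 1" "x = norm x *\<^sub>R u"
  proof (cases "x = 0")
    case True
    then show thesis using that[of "axis undefined 1"] by (simp add: norm_axis_1)
  next
    case False
    then show thesis using that[of "sgn x"] by (simp add: norm_sgn sgn_div_norm)
  qed
  \<comment> \<open>Continuity of \<open>f\<close> is known on \<open>{0..1}\<close> only; the
    cut-off gives a function that is Borel measurable on the whole line and agrees with the
    integrand wherever it is evaluated.\<close>
  define h where "h t = indicator {0..1} t *\<^sub>R f (t * norm x)" for t
  have "continuous_on {0..1} (\<lambda>t. f (t * norm x))"
    using x by (intro continuous_on_compose2[OF f] continuous_intros) (auto intro!: mult_le_one)
  then have h [measurable]: "h \<in> borel_measurable borel"
    unfolding h_def by (intro borel_measurable_continuous_on_indicator) auto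
  have "(LINT \<xi>|unif_sphere. f \<bar>\<xi> \<bullet> x\<bar>) = (LINT \<xi>|unif_sphere. h \<bar>\<xi> \<bullet> u\<bar>)"
  proof (intro Bochner_Integration.integral_cong refl)
    fix \<xi> :: "real ^ 'n" assume "\<xi> \<in> space unif_sphere"
    then have "\<bar>\<xi> \<bullet> u\<bar> \<le> 1"
      using Cauchy_Schwarz_ineq2[of \<xi> u] u by (simp add: space_unif_sphere)
    moreover have "\<bar>\<xi> \<bullet> x\<bar> = \<bar>\<xi> \<bullet> u\<bar> * norm x"
      by (subst u(2)) (simp add: abs_mult)
    ultimately show "f \<bar>\<xi> \<bullet> x\<bar> = h \<bar>\<xi> \<bullet> u\<bar>" by (simp add: h_def)
  qed
  also have "\<dots> = (LINT t|distr unif_sphere borel (\<lambda>\<xi>. \<bar>\<xi> \<bullet> u\<bar>). h t)"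
    by (rule integral_distr[symmetric]) measurable
  also have "\<dots> = (LINT t|lborel. (indicator {0..1} t * slicing_density d t) *\<^sub>R h t)"
    unfolding distr_abs_inner_unif_sphere[OF u(1) d]
    using d slicing_density_nonneg[of d] by (intro integral_density) auto
  also have "\<dots> = slicing d f (norm x)"
    unfolding slicing_def set_lebesgue_integral_def
    by (intro Bochner_Integration.integral_cong) (auto simp: h_def indicator_def)
  finally show ?thesis .
qed

theorem theorem10:
  fixes f F :: "real \<Rightarrow> real" and x :: "real ^ 'n" and d P :: nat
  assumes "CARD('n) = d" and "d \<ge> 3" and "P \<ge> 1"
    and "continuous_on {0..1} f" and "continuous_on {0..1} F"
    and "norm x \<le> 1"
  shows "(slicing_error P f F x)\<^sup>2 =
    \<bar>F (norm x) - slicing d f (norm x)\<bar>\<^sup>2 + slicing_variance f x / real P"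
proof -
  interpret prob_space "unif_sphere :: (real ^ 'n) measure" by (rule prob_space_unif_sphere)
  let ?g = "\<lambda>\<xi>. f \<bar>\<xi> \<bullet> x\<bar>"
  have range: "\<bar>\<xi> \<bullet> x\<bar> \<in> {0..1}" if "\<xi> \<in> space unif_sphere" for \<xi>
    using Cauchy_Schwarz_ineq2[of \<xi> x] that \<open>norm x \<le> 1\<close> by (simp add: space_unif_sphere)
  \<comment> \<open>The same cut-off makes \<open>?g\<close> measurable, since its arguments stay in
    \<open>{0..1}\<close>.\<close>
  have [measurable]: "(\<lambda>t. indicator {0..1} t *\<^sub>R f t) \<in> borel_measurable borel"
    using assms(4) by (intro borel_measurable_continuous_on_indicator) auto
  have meas: "random_variable borel ?g"
  proof -
    have "random_variable borel (\<lambda>\<xi>. indicator {0..1} \<bar>\<xi> \<bullet> x\<bar> *\<^sub>R f \<bar>\<xi> \<bullet> x\<bar>)"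
      by measurable
    then show ?thesis
      by (rule measurable_cong[THEN iffD1, rotated]) (use range in simp)
  qed
  obtain B where B: "\<bar>f t\<bar> \<le> B" if "t \<in> {0..1}" for t
  proof -
    have "compact (f ` {0..1})" using assms(4) by (intro compact_continuous_image) auto
    then have "bounded (f ` {0..1})" by (rule compact_imp_bounded)
    then obtain C where "\<forall>y\<in>f ` {0..1}. norm y \<le> C" unfolding bounded_iff by blast
    then show ?thesis using that[of C] by simp
  qed
  have mean: "expectation ?g = slicing d f (norm x)"
    using assms by (intro slicing_eq_expectation) auto
  have "(slicing_error P f F x)\<^sup>2 =
    (LINT \<xi>|(\<Pi>\<^sub>M p\<in>{1..P}. unif_sphere).
      ((1 / real P) * (\<Sum>p=1..P. ?g (\<xi> p)) - F (norm x))\<^sup>2)"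
    unfolding slicing_error_def by (intro real_sqrt_pow2 Bochner_Integration.integral_nonneg) simp
  also have "\<dots> = (F (norm x) - expectation ?g)\<^sup>2 + variance ?g / real P"
    using meas B[OF range] \<open>P \<ge> 1\<close> by (rule mean_square_error_iid)
  \<comment> \<open>By \<open>mean\<close> the expectation is the slicing value, both in the bias
    and as the centre of the variance.\<close>
  finally show ?thesis
    by (simp add: mean slicing_variance_def assms(1))
qed

end
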